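(* Let $1\le n\le N$. The map $\Phi:(W^0_{n,N},\Omega)\to(T^\star V(n,N),\omega_c)$ given by $(Q,P_0)\mapsto(Q,Q\bar M)$, where $$\bar M=-\tfrac12Q^{\mathsf T}(P_0Q^{\mathsf T}-QP_0^{\mathsf T})Q+Q^{\mathsf T}P_0-P_0^{\mathsf T}Q,$$ is a symplectomorphism.
   Context: $\mathbb R^{nN}$ denotes the real $n\times N$ matrices; $\langle A,B\rangle=\operatorname{Tr}(A^{\mathsf T}B)$; $\mathfrak{so}(N)$ is the space of real skew-symmetric $N\times N$ matrices. $V(n,N)=\{Q\in\mathbb R^{nN}:QQ^{\mathsf T}=I_n\}$ with $T_QV(n,N)=\{QU:U\in\mathfrak{so}(N)\}$. $W^0_{n,N}=\{(Q,P)\in\mathbb R^{nN}\times\mathbb R^{nN}:QQ^{\mathsf T}=I_n,\ QP^{\mathsf T}+PQ^{\mathsf T}=0\}$, with symplectic form $\Omega$ the restriction of the form $\omega((A_1,A_2),(B_1,B_2))=\langle A_1,B_2\rangle-\langle A_2,B_1\rangle$ on $\mathbb R^{nN}\times\mathbb R^{nN}$. The cotangent bundle $T^\star V(n,N)$ is parametrized by pairs $(Q,QM)$ with $Q\in V(n,N)$, $M\in\mathfrak{so}(N)$, where $(Q,QM)$ represents the covector $\langle QM,\cdot\rangle$ on $T_QV(n,N)$. Its canonical symplectic form is $\omega_c=-d\theta$, with $\theta_p(X)=p(\pi_\star X)$ the canonical one-form and $\pi:T^\star V(n,N)\to V(n,N)$ the projection. Explicitly, for tangent vectors $X_i=(QU_i,\,QU_iM+QZ_i)$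 at $(Q,QM)$, with $U_i,Z_i\in\mathfrak{so}(N)$, one has $\omega_c(X_1,X_2)=\langle QU_2M+QZ_2,QU_1\rangle-\langle QU_1M+QZ_1,QU_2\rangle$. *)

theory Defs
  imports "HOL-Analysis.Analysis"
begin

section \<open>Smooth maps and submanifolds of Euclidean spaces\<close>

text \<open>
  On an open subset of a Euclidean space this is the usual class \<open>C\<^sup>k\<close>: all iterated
  directional derivatives up to order \<open>k\<close> exist and are continuous.
\<close>

primrec Ck_on :: "nat \<Rightarrow> ('a::real_normed_vector \<Rightarrow> 'b::real_normed_vector) \<Rightarrow> 'a set \<Rightarrow> bool"
where
  "Ck_on 0 f U \<longleftrightarrow> continuous_on U f"
| "Ck_on (Suc k) f U \<longleftrightarrow>
     (\<forall>x\<in>U. f differentiable (at x)) \<and>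
     (\<forall>v. Ck_on k (\<lambda>x. frechet_derivative f (at x) v) U)"

definition smooth_on :: "('a::real_normed_vector \<Rightarrow> 'b::real_normed_vector) \<Rightarrow> 'a set \<Rightarrow> bool"
  where "smooth_on f U \<longleftrightarrow> (\<forall>k. Ck_on k f U)"

text \<open>
  A \<open>d\<close>-dimensional embedded submanifold is locally the zero set of a smooth submersion.
  The codomain of the submersion is a linear subspace \<open>S\<close> of the ambient space, since
  one cannot quantify over the type of an auxiliary Euclidean space; its dimension
  is the codimension.
\<close>

definition embedded_submanifold :: "nat \<Rightarrow> 'a::euclidean_space set \<Rightarrow> bool"
  where "embedded_submanifold d M \<longleftrightarrow>
    (\<forall>p\<in>M. \<exists>U (F :: 'a \<Rightarrow> 'a) S.
        open U \<and> p \<in> U \<and> subspace S \<and> dim S + d = DIM('a) \<and>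
        smooth_on F U \<and> F ` U \<subseteq> S \<and> M \<inter> U = {x \<in> U. F x = 0} \<and>
        range (frechet_derivative F (at p)) = S)"

definition smooth_curve_at :: "'a::euclidean_space set \<Rightarrow> 'a \<Rightarrow> (real \<Rightarrow> 'a) \<Rightarrow> bool"
  where "smooth_curve_at M p \<gamma> \<longleftrightarrow>
    \<gamma> 0 = p \<and> (\<exists>e>0. smooth_on \<gamma> {-e<..<e} \<and> \<gamma> ` {-e<..<e} \<subseteq> M)"

definition tangent_space :: "'a::euclidean_space set \<Rightarrow> 'a \<Rightarrow> 'a set"
  where "tangent_space M p =
    {X. \<exists>\<gamma>. smooth_curve_at M p \<gamma> \<and> (\<gamma> has_vector_derivative X) (at 0)}"

definition smooth_map :: "'a::euclidean_space set \<Rightarrow> ('a \<Rightarrow> 'b::euclidean_space) \<Rightarrow> bool"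
  where "smooth_map M f \<longleftrightarrow>
    (\<forall>p\<in>M. \<exists>U g. open U \<and> p \<in> U \<and> smooth_on g U \<and> (\<forall>x\<in>M \<inter> U. g x = f x))"

definition diffeomorphism_betw ::
    "'a::euclidean_space set \<Rightarrow> 'b::euclidean_space set \<Rightarrow> ('a \<Rightarrow> 'b) \<Rightarrow> bool"
  where "diffeomorphism_betw M M' f \<longleftrightarrow>
    bij_betw f M M' \<and> smooth_map M f \<and> smooth_map M' (inv_into M f)"

text \<open>
  The differential \<open>f\<^sub>\<star>\<close> of a smooth map \<open>f\<close> defined on \<open>M\<close>, at \<open>p\<close>, applied to the
  tangent vector \<open>X\<close>: it sends \<open>\<gamma>'(0)\<close> to \<open>(f \<circ> \<gamma>)'(0)\<close>.
\<close>

definition pushforward ::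
    "'a::euclidean_space set \<Rightarrow> ('a \<Rightarrow> 'b::euclidean_space) \<Rightarrow> 'a \<Rightarrow> 'a \<Rightarrow> 'b"
  where "pushforward M f p X =
    (THE Y. \<exists>\<gamma>. smooth_curve_at M p \<gamma> \<and> (\<gamma> has_vector_derivative X) (at 0) \<and>
                ((f \<circ> \<gamma>) has_vector_derivative Y) (at 0))"

section \<open>Differential forms and symplectomorphisms\<close>

text \<open>
  A differential form on \<open>M\<close> is a function of a point and of tangent vectors at that point;
  only its values on points of \<open>M\<close> and vectors tangent to \<open>M\<close> are meaningful. Its exterior
  derivative is the restriction of the exterior derivative of any smooth local
  extension to the ambient space (the restriction does not depend on the extension).
\<close>

definition extends_1form ::
    "'a::euclidean_space set \<Rightarrow> ('a \<Rightarrow> 'a \<Rightarrow> real) \<Rightarrow> 'a set \<Rightarrow> ('a \<Rightarrow> 'a \<Rightarrow> real) \<Rightarrow> bool"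
  where "extends_1form M \<theta> U \<Theta> \<longleftrightarrow>
    open U \<and> (\<forall>q\<in>U. linear (\<Theta> q)) \<and> (\<forall>v. smooth_on (\<lambda>q. \<Theta> q v) U) \<and>
    (\<forall>q\<in>M \<inter> U. \<forall>X\<in>tangent_space M q. \<Theta> q X = \<theta> q X)"

definition ext_deriv_1form ::
    "'a::euclidean_space set \<Rightarrow> ('a \<Rightarrow> 'a \<Rightarrow> real) \<Rightarrow> 'a \<Rightarrow> 'a \<Rightarrow> 'a \<Rightarrow> real"
  where "ext_deriv_1form M \<theta> p X Y =
    (THE c. \<exists>U \<Theta>. p \<in> U \<and> extends_1form M \<theta> U \<Theta> \<and>
       c = frechet_derivative (\<lambda>q. \<Theta> q Y) (at p) X - frechet_derivative (\<lambda>q. \<Theta> q X) (at p) Y)"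

definition extends_2form ::
    "'a::euclidean_space set \<Rightarrow> ('a \<Rightarrow> 'a \<Rightarrow> 'a \<Rightarrow> real) \<Rightarrow> 'a set \<Rightarrow> ('a \<Rightarrow> 'a \<Rightarrow> 'a \<Rightarrow> real) \<Rightarrow> bool"
  where "extends_2form M \<omega> U \<Xi> \<longleftrightarrow>
    open U \<and> (\<forall>q\<in>U. bilinear (\<Xi> q) \<and> (\<forall>v. \<Xi> q v v = 0)) \<and>
    (\<forall>v w. smooth_on (\<lambda>q. \<Xi> q v w) U) \<and>
    (\<forall>q\<in>M \<inter> U. \<forall>X\<in>tangent_space M q. \<forall>Y\<in>tangent_space M q. \<Xi> q X Y = \<omega> q X Y)"

definition closed_2form :: "'a::euclidean_space set \<Rightarrow> ('a \<Rightarrow> 'a \<Rightarrow> 'a \<Rightarrow> real) \<Rightarrow> bool"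
  where "closed_2form M \<omega> \<longleftrightarrow>
    (\<forall>p\<in>M. \<exists>U \<Xi>. p \<in> U \<and> extends_2form M \<omega> U \<Xi> \<and>
       (\<forall>X\<in>tangent_space M p. \<forall>Y\<in>tangent_space M p. \<forall>Z\<in>tangent_space M p.
          frechet_derivative (\<lambda>q. \<Xi> q Y Z) (at p) X
          - frechet_derivative (\<lambda>q. \<Xi> q X Z) (at p) Y
          + frechet_derivative (\<lambda>q. \<Xi> q X Y) (at p) Z = 0))"

definition nondegenerate_2form :: "'a::euclidean_space set \<Rightarrow> ('a \<Rightarrow> 'a \<Rightarrow> 'a \<Rightarrow> real) \<Rightarrow> bool"
  where "nondegenerate_2form M \<omega> \<longleftrightarrow>
    (\<forall>p\<in>M. \<forall>X\<in>tangent_space M p. (\<forall>Y\<in>tangent_space M p. \<omega> p X Y = 0) \<longrightarrow> X = 0)"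

definition symplectic_manifold :: "'a::euclidean_space set \<Rightarrow> ('a \<Rightarrow> 'a \<Rightarrow> 'a \<Rightarrow> real) \<Rightarrow> bool"
  where "symplectic_manifold M \<omega> \<longleftrightarrow>
    (\<exists>d. embedded_submanifold d M) \<and> closed_2form M \<omega> \<and> nondegenerate_2form M \<omega>"

definition symplectomorphism ::
    "'a::euclidean_space set \<Rightarrow> ('a \<Rightarrow> 'a \<Rightarrow> 'a \<Rightarrow> real) \<Rightarrow>
     'b::euclidean_space set \<Rightarrow> ('b \<Rightarrow> 'b \<Rightarrow> 'b \<Rightarrow> real) \<Rightarrow> ('a \<Rightarrow> 'b) \<Rightarrow> bool"
  where "symplectomorphism M \<omega> M' \<omega>' f \<longleftrightarrow>
    symplectic_manifold M \<omega> \<and> symplectic_manifold M' \<omega>' \<and> diffeomorphism_betw M M' f \<and>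
    (\<forall>p\<in>M. \<forall>X\<in>tangent_space M p. \<forall>Y\<in>tangent_space M p.
       \<omega>' (f p) (pushforward M f p X) (pushforward M f p Y) = \<omega> p X Y)"

section \<open>The Stiefel manifold and its cotangent bundle\<close>

definition frob :: "real^'N^'n \<Rightarrow> real^'N^'n \<Rightarrow> real"
  where "frob A B = trace (transpose A ** B)"

definition so :: "(real^'N^'N) set"
  where "so = {U. transpose U = - U}"

definition stiefel :: "(real^'N^'n) set"
  where "stiefel = {Q. Q ** transpose Q = mat 1}"

definition W0 :: "((real^'N^'n) \<times> (real^'N^'n)) set"
  where "W0 = {(Q, P). Q ** transpose Q = mat 1 \<and> Q ** transpose P + P ** transpose Q = 0}"

definition Omega ::
    "(real^'N^'n) \<times> (real^'N^'n) \<Rightarrow> (real^'N^'n) \<times> (real^'N^'n) \<Rightarrow>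
     (real^'N^'n) \<times> (real^'N^'n) \<Rightarrow> real"
  where "Omega p X Y = frob (fst X) (snd Y) - frob (snd X) (fst Y)"

text \<open>
  The pair \<open>(Q, QM)\<close> stands for the covector \<open>\<langle>QM, \<cdot>\<rangle>\<close> on the tangent space of the Stiefel
  manifold at \<open>Q\<close>. As that tangent space is \<open>{QU | U \<in> so(N)}\<close>, every covector
  is represented by exactly one such pair.
\<close>

definition cotangent_stiefel :: "((real^'N^'n) \<times> (real^'N^'n)) set"
  where "cotangent_stiefel = {(Q, Q ** M) | Q M. Q \<in> stiefel \<and> M \<in> so}"

definition covector :: "(real^'N^'n) \<times> (real^'N^'n) \<Rightarrow> real^'N^'n \<Rightarrow> real"
  where "covector p = frob (snd p)"

definition theta :: "(real^'N^'n) \<times> (real^'N^'n) \<Rightarrow> (real^'N^'n) \<times> (real^'N^'n) \<Rightarrow> real"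
  where "theta p X = covector p (pushforward cotangent_stiefel fst p X)"

definition omega_c ::
    "(real^'N^'n) \<times> (real^'N^'n) \<Rightarrow> (real^'N^'n) \<times> (real^'N^'n) \<Rightarrow>
     (real^'N^'n) \<times> (real^'N^'n) \<Rightarrow> real"
  where "omega_c p X Y = - ext_deriv_1form cotangent_stiefel theta p X Y"

definition Mbar :: "real^'N^'n \<Rightarrow> real^'N^'n \<Rightarrow> real^'N^'N"
  where "Mbar Q P =
    (- 1 / 2) *\<^sub>R (transpose Q ** (P ** transpose Q - Q ** transpose P) ** Q)
    + transpose Q ** P - transpose P ** Q"

definition Phi :: "(real^'N^'n) \<times> (real^'N^'n) \<Rightarrow> (real^'N^'n) \<times> (real^'N^'n)"
  where "Phi = (\<lambda>(Q, P). (Q, Q ** Mbar Q P))"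

end

theory Submission
  imports Defs
begin

text \<open>
  On \<open>W0\<close> one has \<open>Q ** Mbar Q P = P\<close>, because \<open>Q ** transpose P\<close> is skew. Hence the two
  manifolds coincide as sets and \<open>Phi\<close> is the identity, and what remains is that \<open>omega_c\<close> is
  \<open>Omega\<close> on tangent vectors. The canonical one-form extends to the ambient space as
  \<open>snd p \<bullet> fst X\<close>, whose exterior derivative is \<open>- Omega\<close>. That the exterior derivative
  may be computed from any extension follows from the fact that the tangent spaces are
  spanned by the values of a Lie algebra of linear vector fields
  \<open>(Q, P) \<mapsto> (Q ** U, P ** U + Q ** Z)\<close> with \<open>U\<close>, \<open>Z\<close> skew, whose flows preserve \<open>W0\<close>.
\<close>

section \<open>Smooth functions\<close>

lemma Ck_on_const: "Ck_on k (\<lambda>x. c) U"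
  by (induction k arbitrary: c) simp_all

lemma Ck_on_bounded_linear:
  assumes "bounded_linear f"
  shows "Ck_on k f U"
proof (cases k)
  case 0
  then show ?thesis using assms by (simp add: linear_continuous_on)
next
  case (Suc m)
  have d: "(f has_derivative f) (at x)" for x
    using assms by (rule bounded_linear_imp_has_derivative)
  have "frechet_derivative f (at x) = f" for x
    using frechet_derivative_at[OF d] by simp
  with d show ?thesis
    by (auto simp: Suc Ck_on_const differentiable_def)
qed

lemma smooth_on_bounded_linear: "bounded_linear f \<Longrightarrow> smooth_on f U"
  by (simp add: smooth_on_def Ck_on_bounded_linear)

lemma has_derivative_quadratic:
  assumes "bounded_bilinear B"
  shows "((\<lambda>x. B x x + c) has_derivative (\<lambda>v. B x v + B v x)) (at x)"
  by (auto intro!: derivative_eq_intros bounded_bilinear.FDERIV[OF assms])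

text \<open>Each directional derivative is linear in the base point, so
  \<open>Ck_on_bounded_linear\<close> settles all remaining orders. The defining equations of
  \<open>W0\<close> have this quadratic form.\<close>

lemma smooth_on_quadratic:
  assumes "bounded_bilinear B"
  shows "smooth_on (\<lambda>x. B x x + c) U"
proof -
  note d = has_derivative_quadratic[OF assms, of c]
  have fd: "frechet_derivative (\<lambda>x. B x x + c) (at x) = (\<lambda>v. B x v + B v x)" for x
    using frechet_derivative_at[OF d] by simp
  have "bounded_linear (\<lambda>x. B x v + B v x)" for v
    by (intro bounded_linear_add bounded_bilinear.bounded_linear_left[OF assms]
        bounded_bilinear.bounded_linear_right[OF assms])
  then have "Ck_on k (\<lambda>x. B x x + c) U" for k
  proof (cases k)
    case 0
    have "continuous (at x within U) (\<lambda>x. B x x + c)" for x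
      using has_derivative_at_withinI[OF d] by (rule has_derivative_continuous)
    then show ?thesis by (simp add: 0 continuous_on_eq_continuous_within)
  next
    case (Suc m)
    with d show ?thesis
      using \<open>\<And>v. bounded_linear (\<lambda>x. B x v + B v x)\<close>
      by (auto simp: fd differentiable_def intro!: Ck_on_bounded_linear)
  qed
  then show ?thesis by (simp add: smooth_on_def)
qed

lemma smooth_on_imp_differentiable:
  "smooth_on f U \<Longrightarrow> x \<in> U \<Longrightarrow> f differentiable (at x)"
  by (metis Ck_on.simps(2) smooth_on_def)

section \<open>Flows of linear vector fields\<close>

lemma norm_funpow_le:
  fixes L :: "'a::real_normed_vector \<Rightarrow> 'a"
  assumes "\<And>x. norm (L x) \<le> K * norm x" and "K \<ge> 0"
  shows "norm ((L ^^ n) p) \<le> K ^ n * norm p"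
proof (induction n)
  case (Suc n)
  have "norm ((L ^^ Suc n) p) \<le> K * norm ((L ^^ n) p)"
    using assms(1)[of "(L ^^ n) p"] by simp
  also have "\<dots> \<le> K * (K ^ n * norm p)"
    using Suc assms(2) by (rule mult_left_mono)
  finally show ?case by (simp add: mult_ac)
qed simp

text \<open>The curve is exp(tL) p. Its inner product with a fixed vector is a scalar power series
  in t, which may be differentiated term by term.\<close>

lemma linear_flow:
  fixes L :: "'a::euclidean_space \<Rightarrow> 'a"
  assumes "linear L"
  obtains \<gamma> :: "real \<Rightarrow> 'a" where "\<gamma> 0 = p"
    and "\<And>t. (\<gamma> has_vector_derivative L (\<gamma> t)) (at t)"
proof -
  have bl: "bounded_linear L"
    using assms by (simp add: linear_conv_bounded_linear)
  obtain K where K: "K > 0" "\<And>x. norm (L x) \<le> K * norm x"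
    using linear_bounded_pos[OF assms] by blast
  have nb: "norm ((t ^ n / fact n) *\<^sub>R (L ^^ n) q) \<le> norm q * ((K * \<bar>t\<bar>) ^ n /\<^sub>R fact n)"
    for t :: real and n q
  proof -
    have "norm ((t ^ n / fact n) *\<^sub>R (L ^^ n) q) = (\<bar>t\<bar> ^ n / fact n) * norm ((L ^^ n) q)"
      by (simp add: power_abs)
    also have "\<dots> \<le> (\<bar>t\<bar> ^ n / fact n) * (K ^ n * norm q)"
      using K by (intro mult_left_mono norm_funpow_le) auto
    finally show ?thesis by (simp add: field_simps power_mult_distrib)
  qed
  have sm: "summable (\<lambda>n. (t ^ n / fact n) *\<^sub>R (L ^^ n) q)" for t :: real and q
    by (rule summable_comparison_test'[where N = 0, OF _ nb])
      (intro summable_mult summable_exp_generic)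
  define \<gamma> where "\<gamma> t = (\<Sum>n. (t ^ n / fact n) *\<^sub>R (L ^^ n) p)" for t :: real
  have sm': "summable (\<lambda>n. ((L ^^ n) q \<bullet> b) / fact n * t ^ n)" for t :: real and b q
    using bounded_linear.summable[OF bounded_linear_inner_left[of b] sm[of t q]]
    by (simp add: mult_ac)
  have inner: "\<gamma> t \<bullet> b = (\<Sum>n. ((L ^^ n) p \<bullet> b) / fact n * t ^ n)" for t b
    using bounded_linear.suminf[OF bounded_linear_inner_left[of b] sm[of t p]]
    by (simp add: \<gamma>_def mult_ac)
  have "L (\<gamma> t) = (\<Sum>n. (t ^ n / fact n) *\<^sub>R (L ^^ n) (L p))" for t
    using bounded_linear.suminf[OF bl sm[of t p]]
    by (simp add: \<gamma>_def linear_scale[OF assms] funpow_swap1)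
  then have L\<gamma>: "L (\<gamma> t) \<bullet> b = (\<Sum>n. ((L ^^ n) (L p) \<bullet> b) / fact n * t ^ n)" for t b
    using bounded_linear.suminf[OF bounded_linear_inner_left[of b] sm[of t "L p"]]
    by (simp add: mult_ac)
  have "(\<gamma> has_vector_derivative L (\<gamma> t)) (at t)" for t
  proof -
    have "((\<lambda>t. \<gamma> t \<bullet> b) has_field_derivative L (\<gamma> t) \<bullet> b) (at t)" for b
    proof -
      \<comment> \<open>The factor \<open>Suc n\<close> produced by \<open>diffs\<close> cancels
        against \<open>fact (Suc n)\<close>, and the additional power of \<open>L\<close> is
        absorbed into \<open>L p\<close>.\<close>
      have "diffs (\<lambda>n. ((L ^^ n) p \<bullet> b) / fact n) = (\<lambda>n. ((L ^^ n) (L p) \<bullet> b) / fact n)"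
        by (simp add: diffs_def fun_eq_iff funpow_swap1 del: of_nat_Suc)
      then show ?thesis
        using termdiffs_strong_converges_everywhere[OF sm'[of p b], of t]
        by (simp add: inner L\<gamma>)
    qed
    then show ?thesis
      unfolding has_vector_derivative_def
      by (subst has_derivative_componentwise_within)
        (simp add: has_field_derivative_def mult_commute_abs)
  qed
  moreover have "\<gamma> 0 = p"
  proof -
    have "\<gamma> 0 = (\<Sum>n. if n = 0 then p else 0)"
      unfolding \<gamma>_def by (rule suminf_cong) auto
    also have "\<dots> = p"
      using suminf_finite[of "{0::nat}" "\<lambda>n. if n = 0 then p else 0"] by simp
    finally show ?thesis .
  qed
  ultimately show thesis using that by blast
qed

lemma smooth_on_linear_flow:
  fixes L :: "'a::real_normed_vector \<Rightarrow> 'a"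
  assumes L: "bounded_linear L"
    and \<gamma>: "\<And>t. (\<gamma> has_vector_derivative L (\<gamma> t)) (at t)"
  shows "smooth_on \<gamma> U"
proof -
  \<comment> \<open>The induction ranges over all \<open>A\<close>, because differentiating replaces
    \<open>A\<close> by a multiple of \<open>A\<close> composed with \<open>L\<close>.\<close>
  have "Ck_on k (\<lambda>t. A (\<gamma> t)) U" if "bounded_linear A" for k and A :: "'a \<Rightarrow> 'a"
    using that
  proof (induction k arbitrary: A)
    case 0
    have "continuous_on U \<gamma>"
      using \<gamma> by (meson continuous_at_imp_continuous_on has_vector_derivative_continuous)
    with 0 show ?case by (simp add: bounded_linear.continuous_on)
  next
    case (Suc k)
    have d: "((\<lambda>t. A (\<gamma> t)) has_derivative (\<lambda>v. v *\<^sub>R A (L (\<gamma> t)))) (at t)" for t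
      using bounded_linear.has_vector_derivative[OF Suc.prems \<gamma>]
      by (simp add: has_vector_derivative_def)
    have fd: "frechet_derivative (\<lambda>t. A (\<gamma> t)) (at t) = (\<lambda>v. v *\<^sub>R A (L (\<gamma> t)))" for t
      using frechet_derivative_at[OF d] by simp
    have "bounded_linear (\<lambda>x. v *\<^sub>R A (L x))" for v
      using bounded_linear_compose[OF Suc.prems L]
      by (rule bounded_linear_const_scaleR)
    from Suc.IH[OF this] d show ?case
      by (auto simp: fd differentiable_def)
  qed
  from this[of "\<lambda>x. x"] show ?thesis by (simp add: smooth_on_def bounded_linear_ident)
qed

section \<open>Tangent vectors and the exterior derivative\<close>

lemma has_vector_derivative_eventually_eq:
  assumes "(f has_vector_derivative D) (at t)" "\<forall>\<^sub>F x in nhds t. f x = g x"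
  shows "(g has_vector_derivative D) (at t)"
  using assms has_vector_derivative_cong_ev[of UNIV f g t D] eventually_nhds_x_imp_x by force

lemma smooth_curve_at_eventually:
  assumes "smooth_curve_at M p \<gamma>"
  shows "\<forall>\<^sub>F t in nhds 0. \<gamma> t \<in> M"
proof -
  obtain e where e: "e > 0" "\<gamma> ` {-e<..<e} \<subseteq> M"
    using assms by (auto simp: smooth_curve_at_def)
  have "\<forall>\<^sub>F t in nhds 0. t \<in> {-e<..<e}"
    using e(1) by (intro eventually_nhds_in_open) auto
  then show ?thesis by eventually_elim (use e in auto)
qed

lemma tangent_spaceE:
  assumes "X \<in> tangent_space M p"
  obtains \<gamma> where "smooth_curve_at M p \<gamma>" "(\<gamma> has_vector_derivative X) (at 0)"
  using assms by (auto simp: tangent_space_def)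

text \<open>Tangency of \<open>X\<close> supplies a curve, and a common derivative \<open>Y\<close>
  for all curves with velocity \<open>X\<close> makes the described vector unique.\<close>

lemma pushforward_eqI:
  assumes X: "X \<in> tangent_space M p"
    and g: "\<And>\<gamma>. smooth_curve_at M p \<gamma> \<Longrightarrow> (\<gamma> has_vector_derivative X) (at 0) \<Longrightarrow>
              ((f \<circ> \<gamma>) has_vector_derivative Y) (at 0)"
  shows "pushforward M f p X = Y"
proof -
  obtain \<gamma> where \<gamma>: "smooth_curve_at M p \<gamma>" "(\<gamma> has_vector_derivative X) (at 0)"
    using X by (rule tangent_spaceE)
  show ?thesis
    unfolding pushforward_def
  proof (rule the_equality)
    show "\<exists>\<gamma>. smooth_curve_at M p \<gamma> \<and> (\<gamma> has_vector_derivative X) (at 0) \<and>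
      ((f \<circ> \<gamma>) has_vector_derivative Y) (at 0)"
      using \<gamma> g by blast
  qed (use g vector_derivative_unique_at in blast)
qed

text \<open>The integral curve of \<open>L\<close> through \<open>p\<close> is smooth, stays in
  \<open>M\<close>, and has velocity \<open>L p\<close> at time 0.\<close>

lemma tangent_space_linear_flow:
  assumes L: "linear L"
    and inv: "\<And>\<gamma> t. \<gamma> 0 = p \<Longrightarrow> (\<And>t. (\<gamma> has_vector_derivative L (\<gamma> t)) (at t)) \<Longrightarrow> \<gamma> t \<in> M"
  shows "L p \<in> tangent_space M p"
proof -
  obtain \<gamma> where \<gamma>: "\<gamma> 0 = p" "\<And>t. (\<gamma> has_vector_derivative L (\<gamma> t)) (at t)"
    using linear_flow[OF L] by blast
  have "smooth_on \<gamma> U" for U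
    using L \<gamma>(2) by (intro smooth_on_linear_flow[of L]) (auto simp: linear_conv_bounded_linear)
  with inv[OF \<gamma>] \<gamma>(1) have "smooth_curve_at M p \<gamma>"
    by (auto simp: smooth_curve_at_def intro!: exI[of _ 1])
  with \<gamma> show ?thesis
    unfolding tangent_space_def by (metis (mono_tags, lifting) mem_Collect_eq)
qed

text \<open>This is the product rule for pairing a form with a vector field. Differentiability is
  given only for a fixed vector argument, so the pairing is first expanded over the basis into a
  finite sum of products.\<close>

lemma has_derivative_form_linear_field:
  fixes \<Theta> :: "'a::euclidean_space \<Rightarrow> 'a \<Rightarrow> real"
  assumes "open U" "p \<in> U" and lin: "\<forall>q\<in>U. linear (\<Theta> q)"
    and diff: "\<And>v. (\<lambda>q. \<Theta> q v) differentiable (at p)" and L: "linear L"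
  shows "((\<lambda>q. \<Theta> q (L q)) has_derivative
           (\<lambda>h. frechet_derivative (\<lambda>q. \<Theta> q (L p)) (at p) h + \<Theta> p (L h))) (at p)"
proof -
  let ?D = "\<lambda>v. frechet_derivative (\<lambda>q. \<Theta> q v) (at p)"
  have D: "((\<lambda>q. \<Theta> q v) has_derivative ?D v) (at p)" for v
    using diff frechet_derivative_works by blast
  have expand: "\<Theta> q v = (\<Sum>b\<in>Basis. (v \<bullet> b) * \<Theta> q b)" if "q \<in> U" for q v
  proof -
    interpret linear "\<Theta> q" using lin that by blast
    have "\<Theta> q v = \<Theta> q (\<Sum>b\<in>Basis. (v \<bullet> b) *\<^sub>R b)" by (simp add: euclidean_representation)
    also have "\<dots> = (\<Sum>b\<in>Basis. (v \<bullet> b) * \<Theta> q b)" by (simp add: sum scale)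
    finally show ?thesis .
  qed
  have L': "(L has_derivative L) (at p)"
    using L by (simp add: linear_imp_has_derivative)
  have "((\<lambda>q. \<Sum>b\<in>Basis. (v \<bullet> b) * \<Theta> q b) has_derivative (\<lambda>h. \<Sum>b\<in>Basis. (v \<bullet> b) * ?D b h)) (at p)" for v
    by (auto intro!: derivative_eq_intros D)
  then have "((\<lambda>q. \<Theta> q v) has_derivative (\<lambda>h. \<Sum>b\<in>Basis. (v \<bullet> b) * ?D b h)) (at p)" for v
    by (rule has_derivative_transform_within_open[OF _ assms(1,2)]) (simp add: expand)
  \<comment> \<open>Uniqueness of derivatives makes \<open>?D v\<close> linear in \<open>v\<close>.
    This later collapses the basis sum to the derivative with \<open>L p\<close> held fixed.\<close>
  then have Dv: "?D v = (\<lambda>h. \<Sum>b\<in>Basis. (v \<bullet> b) * ?D b h)" for v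
    using D has_derivative_unique by blast
  have "((\<lambda>q. \<Sum>b\<in>Basis. (L q \<bullet> b) * \<Theta> q b) has_derivative
      (\<lambda>h. \<Sum>b\<in>Basis. (L p \<bullet> b) * ?D b h + (L h \<bullet> b) * \<Theta> p b)) (at p)"
    by (auto intro!: derivative_eq_intros D L')
  then have "((\<lambda>q. \<Theta> q (L q)) has_derivative
      (\<lambda>h. \<Sum>b\<in>Basis. (L p \<bullet> b) * ?D b h + (L h \<bullet> b) * \<Theta> p b)) (at p)"
    by (rule has_derivative_transform_within_open[OF _ assms(1,2)]) (simp add: expand)
  moreover have "(\<Sum>b\<in>Basis. (L p \<bullet> b) * ?D b h + (L h \<bullet> b) * \<Theta> p b)
      = ?D (L p) h + \<Theta> p (L h)" for h
    using fun_cong[OF Dv[of "L p"], of h] expand[OF assms(2), of "L h"] by (simp add: sum.distrib)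
  ultimately show ?thesis by simp
qed

text \<open>Since \<open>L\<close> is tangent to \<open>M\<close>, both extensions give the same
  pairing with \<open>L\<close> along a curve in \<open>M\<close> with velocity \<open>X\<close>;
  the product rule then computes its derivative in two ways. The summands need not agree separately,
  as \<open>L X\<close> need not be tangent.\<close>

lemma extends_1form_along_linear_field:
  assumes e1: "extends_1form M \<theta> U \<Theta>" and e2: "extends_1form M \<theta> V \<Psi>"
    and p: "p \<in> U" "p \<in> V" and L: "linear L"
    and tan: "\<And>q. q \<in> M \<Longrightarrow> L q \<in> tangent_space M q"
    and X: "X \<in> tangent_space M p"
  shows "frechet_derivative (\<lambda>q. \<Theta> q (L p)) (at p) X + \<Theta> p (L X)
       = frechet_derivative (\<lambda>q. \<Psi> q (L p)) (at p) X + \<Psi> p (L X)"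
proof -
  obtain \<gamma> where \<gamma>: "smooth_curve_at M p \<gamma>" "(\<gamma> has_vector_derivative X) (at 0)"
    using X by (rule tangent_spaceE)
  then have [simp]: "\<gamma> 0 = p" by (simp add: smooth_curve_at_def)
  have chain: "((\<lambda>t. \<Xi> (\<gamma> t) (L (\<gamma> t))) has_vector_derivative
      frechet_derivative (\<lambda>q. \<Xi> q (L p)) (at p) X + \<Xi> p (L X)) (at 0)"
    if "extends_1form M \<theta> W \<Xi>" "p \<in> W" for W \<Xi>
  proof -
    define G where "G h = frechet_derivative (\<lambda>q. \<Xi> q (L p)) (at p) h + \<Xi> p (L h)" for h
    have G: "((\<lambda>q. \<Xi> q (L q)) has_derivative G) (at (\<gamma> 0))"
      unfolding G_def \<open>\<gamma> 0 = p\<close>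
    proof (rule has_derivative_form_linear_field[OF _ that(2) _ _ L])
      show "(\<lambda>q. \<Xi> q v) differentiable (at p)" for v
        using that unfolding extends_1form_def by (blast intro: smooth_on_imp_differentiable)
    qed (use that(1) in \<open>auto simp: extends_1form_def\<close>)
    have "((\<lambda>t. \<Xi> (\<gamma> t) (L (\<gamma> t))) has_derivative (\<lambda>t. G (t *\<^sub>R X))) (at 0)"
      using has_derivative_compose[OF \<gamma>(2)[unfolded has_vector_derivative_def] G] .
    then show ?thesis
      by (simp add: has_vector_derivative_def linear_scale[OF has_derivative_linear[OF G]]
          flip: G_def)
  qed
  have "(\<gamma> \<longlongrightarrow> p) (nhds 0)"
    using has_vector_derivative_continuous[OF \<gamma>(2)]
    unfolding continuous_at tendsto_at_iff_tendsto_nhds by simp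
  then have "\<forall>\<^sub>F t in nhds 0. \<gamma> t \<in> U \<inter> V"
    by (rule topological_tendstoD) (use p e1 e2 in \<open>auto simp: extends_1form_def\<close>)
  with smooth_curve_at_eventually[OF \<gamma>(1)]
  have "\<forall>\<^sub>F t in nhds 0. \<Theta> (\<gamma> t) (L (\<gamma> t)) = \<Psi> (\<gamma> t) (L (\<gamma> t))"
  proof eventually_elim
    case (elim t)
    then show ?case using e1 e2 tan unfolding extends_1form_def by auto
  qed
  with chain[OF e1 p(1)] have "((\<lambda>t. \<Psi> (\<gamma> t) (L (\<gamma> t))) has_vector_derivative
      frechet_derivative (\<lambda>q. \<Theta> q (L p)) (at p) X + \<Theta> p (L X)) (at 0)"
    by (intro has_vector_derivative_eventually_eq[where g = "\<lambda>t. \<Psi> (\<gamma> t) (L (\<gamma> t))"])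
  then show ?thesis
    using chain[OF e2 p(2)] vector_derivative_unique_at by blast
qed

text \<open>
  Differentiating two extensions along tangent linear fields shows that their exterior
  derivatives differ by their values on the commutator of the fields, on which they agree.
\<close>

lemma ext_deriv_1form_linear_fields:
  assumes e: "extends_1form M \<theta> U \<Theta>" and p: "p \<in> U" "p \<in> M"
    and L: "linear K" "linear L"
    and tan: "\<And>q. q \<in> M \<Longrightarrow> K q \<in> tangent_space M q"
      "\<And>q. q \<in> M \<Longrightarrow> L q \<in> tangent_space M q"
    and comm: "L (K p) - K (L p) \<in> tangent_space M p"
  shows "ext_deriv_1form M \<theta> p (K p) (L p) =
    frechet_derivative (\<lambda>q. \<Theta> q (L p)) (at p) (K p) -
    frechet_derivative (\<lambda>q. \<Theta> q (K p)) (at p) (L p)"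
  unfolding ext_deriv_1form_def
proof (rule the_equality)
  fix c
  assume "\<exists>V \<Psi>. p \<in> V \<and> extends_1form M \<theta> V \<Psi> \<and>
    c = frechet_derivative (\<lambda>q. \<Psi> q (L p)) (at p) (K p) -
        frechet_derivative (\<lambda>q. \<Psi> q (K p)) (at p) (L p)"
  then obtain V \<Psi> where V: "p \<in> V" "extends_1form M \<theta> V \<Psi>"
    and c: "c = frechet_derivative (\<lambda>q. \<Psi> q (L p)) (at p) (K p) -
        frechet_derivative (\<lambda>q. \<Psi> q (K p)) (at p) (L p)" by blast
  note 1 = extends_1form_along_linear_field[OF e V(2) p(1) V(1) L(2) tan(2) tan(1)[OF p(2)]]
  note 2 = extends_1form_along_linear_field[OF e V(2) p(1) V(1) L(1) tan(1) tan(2)[OF p(2)]]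
  have "\<Theta> p (L (K p) - K (L p)) = \<Psi> p (L (K p) - K (L p))"
    using e V p comm unfolding extends_1form_def by auto
  moreover have "linear (\<Theta> p)" "linear (\<Psi> p)"
    using e V p unfolding extends_1form_def by auto
  ultimately have "\<Theta> p (L (K p)) - \<Theta> p (K (L p)) = \<Psi> p (L (K p)) - \<Psi> p (K (L p))"
    by (simp add: linear_diff)
  with 1 2 show "c = frechet_derivative (\<lambda>q. \<Theta> q (L p)) (at p) (K p) -
    frechet_derivative (\<lambda>q. \<Theta> q (K p)) (at p) (L p)"
    by (simp add: c)
qed (use e p in blast)

text \<open>The form has an extension with constant coefficients, whose derivatives all
  vanish.\<close>

lemma closed_2form_constant:
  assumes "bilinear \<Xi>" "\<And>v. \<Xi> v v = 0"
    and "\<And>p X Y. p \<in> M \<Longrightarrow> X \<in> tangent_space M p \<Longrightarrow> Y \<in> tangent_space M p \<Longrightarrow> \<omega> p X Y = \<Xi> X Y"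
  shows "closed_2form M \<omega>"
  unfolding closed_2form_def
proof (intro ballI exI conjI)
  show "extends_2form M \<omega> UNIV (\<lambda>_. \<Xi>)"
    using assms by (simp add: extends_2form_def smooth_on_def Ck_on_const)
qed (simp_all add: frechet_derivative_const)

section \<open>The Stiefel manifold\<close>

lemma bilinear_matrix_mult:
  "bilinear ((**) :: real^'m::finite^'n::finite \<Rightarrow> real^'k::finite^'m \<Rightarrow> real^'k^'n)"
  by (auto simp: bilinear_def linear_iff matrix_matrix_mult_def vec_eq_iff sum.distrib
      sum_distrib_left algebra_simps)

interpretation matrix_mult: bounded_bilinear
  "(**) :: real^'m::finite^'n::finite \<Rightarrow> real^'k::finite^'m \<Rightarrow> real^'k^'n"
  using bilinear_matrix_mult by (simp add: bilinear_conv_bounded_bilinear)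

lemma linear_transpose: "linear (transpose :: real^'m::finite^'n::finite \<Rightarrow> real^'n^'m)"
  by (auto simp: linear_iff transpose_def vec_eq_iff)

text \<open>Rewriting with these expands products, moves transposes onto the factors and associates
  to the left, so that matrix identities become linear relations between monomials.\<close>

lemmas matrix_simps =
  matrix_mult.add_left matrix_mult.add_right matrix_mult.diff_left matrix_mult.diff_right
  matrix_mult.minus_left matrix_mult.minus_right matrix_mult.zero_left matrix_mult.zero_right
  matrix_mult.scaleR_left matrix_mult.scaleR_right matrix_mul_assoc matrix_transpose_mul
  linear_add[OF linear_transpose] linear_diff[OF linear_transpose]
  linear_neg[OF linear_transpose] linear_0[OF linear_transpose]
  linear_scale[OF linear_transpose] transpose_transpose

lemma frob_eq_inner: "frob A B = A \<bullet> B"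
  unfolding frob_def trace_def matrix_matrix_mult_def transpose_def inner_vec_def
  by (simp, rule sum.swap)

section \<open>The skew matrix \<open>Mbar\<close> and the equality of the two manifolds\<close>

lemma Mbar_in_so: "Mbar Q P \<in> so"
  by (simp add: so_def Mbar_def matrix_simps algebra_simps)

text \<open>Put S = Q P^T, so that P Q^T = -S. After multiplication by Q the three terms of
  \<open>Mbar\<close> become S Q, P and -S Q. Besides fixing \<open>Phi\<close> on
  \<open>W0\<close>, this solves Q U = A for a skew U when A is tangent at Q.\<close>

lemma mult_Mbar:
  assumes "Q ** transpose Q = mat 1" and "Q ** transpose P + P ** transpose Q = 0"
  shows "Q ** Mbar Q P = P"
proof -
  have P: "P ** transpose Q = - (Q ** transpose P)"
    using assms(2) by (simp add: add_eq_0_iff)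
  have "Q ** Mbar Q P = (- 1 / 2) *\<^sub>R (- (Q ** transpose P) - Q ** transpose P) ** Q
      + P - Q ** transpose P ** Q"
    by (simp add: Mbar_def matrix_simps assms(1) flip: P)
  also have "\<dots> = P"
    by (simp add: matrix_simps vec_eq_iff)
  finally show ?thesis .
qed

lemma mult_so:
  assumes "M \<in> so"
  shows "Q ** transpose (Q ** M) + Q ** M ** transpose Q = 0"
  using assms by (simp add: so_def matrix_simps)

lemma cotangent_stiefel_eq_W0: "cotangent_stiefel = W0"
proof (intro equalityI subsetI)
  fix x assume "x \<in> cotangent_stiefel"
  then show "x \<in> W0"
    by (auto simp: cotangent_stiefel_def W0_def stiefel_def mult_so)
next
  fix x assume "x \<in> W0"
  then obtain Q P where x: "x = (Q, P)" "Q ** transpose Q = mat 1"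
    "Q ** transpose P + P ** transpose Q = 0" by (auto simp: W0_def)
  then have "x = (Q, Q ** Mbar Q P)" by (simp add: mult_Mbar)
  with x Mbar_in_so show "x \<in> cotangent_stiefel"
    unfolding cotangent_stiefel_def stiefel_def by blast
qed

lemma Phi_W0: "x \<in> W0 \<Longrightarrow> Phi x = x"
  by (auto simp: W0_def Phi_def mult_Mbar)

section \<open>Constraints and tangent spaces of \<open>W0\<close>\<close>

text \<open>The defining equations are the diagonal of this bilinear map, so the product rule gives
  their linearisation at \<open>x\<close> as \<open>constr x v + constr v x\<close>.\<close>

definition constr ::
    "(real^'N^'n) \<times> (real^'N^'n) \<Rightarrow> (real^'N^'n) \<times> (real^'N^'n) \<Rightarrow> (real^'n^'n) \<times> (real^'n^'n)"
  where "constr x y = (fst x ** transpose (fst y),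
    fst x ** transpose (snd y) + snd x ** transpose (fst y))"

lemma W0_iff_constr: "x \<in> W0 \<longleftrightarrow> constr x x = (mat 1, 0)"
  by (cases x) (simp add: W0_def constr_def)

lemma bounded_bilinear_constr: "bounded_bilinear constr"
  unfolding bilinear_conv_bounded_bilinear[symmetric]
  by (auto simp: bilinear_def linear_iff constr_def matrix_simps algebra_simps)

lemma has_vector_derivative_constr:
  assumes "(\<gamma> has_vector_derivative X) (at t)"
  shows "((\<lambda>t. constr (\<gamma> t) (\<gamma> t)) has_vector_derivative
    constr (\<gamma> t) X + constr X (\<gamma> t)) (at t)"
  using bounded_bilinear.has_vector_derivative[OF bounded_bilinear_constr assms assms] .

text \<open>
  The infinitesimal action of the tangent group of \<open>O(N)\<close>, which acts transitively on \<open>W0\<close>.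
\<close>

definition lfield ::
    "real^'N^'N \<Rightarrow> real^'N^'N \<Rightarrow> (real^'N^'n) \<times> (real^'N^'n) \<Rightarrow> (real^'N^'n) \<times> (real^'N^'n)"
  where "lfield U Z x = (fst x ** U, snd x ** U + fst x ** Z)"

lemma linear_lfield: "linear (lfield U Z)"
  by (auto simp: linear_iff lfield_def matrix_simps algebra_simps)

text \<open>The fields form a Lie algebra. The parameters on the right are grouped into matrix
  commutators, so they are skew whenever the four given matrices are.\<close>

lemma lfield_commutator:
  "lfield U' Z' (lfield U Z x) - lfield U Z (lfield U' Z' x) =
   lfield (U ** U' - U' ** U) (Z ** U' - U' ** Z + (U ** Z' - Z' ** U)) x"
  by (simp add: lfield_def matrix_simps algebra_simps)

lemma so_commutator: "U \<in> so \<Longrightarrow> Z \<in> so \<Longrightarrow> U ** Z - Z ** U \<in> so"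
  by (simp add: so_def matrix_simps)

lemma so_add: "U \<in> so \<Longrightarrow> Z \<in> so \<Longrightarrow> U + Z \<in> so"
  by (simp add: so_def matrix_simps)

lemma constr_lfield:
  assumes "U \<in> so" "Z \<in> so"
  shows "constr x (lfield U Z x) + constr (lfield U Z x) x = 0"
  using assms by (simp add: constr_def lfield_def so_def matrix_simps zero_prod_def)

text \<open>By \<open>constr_lfield\<close>, the constraint map is constant along integral curves,
  so a curve starting in \<open>W0\<close> never leaves it.\<close>

lemma lfield_in_tangent_space:
  fixes x :: "(real^'N::finite^'n::finite) \<times> (real^'N^'n)"
  assumes x: "x \<in> W0" and so: "U \<in> so" "Z \<in> so"
  shows "lfield U Z x \<in> tangent_space W0 x"
proof (rule tangent_space_linear_flow[OF linear_lfield])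
  fix \<gamma> :: "real \<Rightarrow> (real^'N^'n) \<times> (real^'N^'n)" and t
  assume \<gamma>: "\<gamma> 0 = x" "\<And>t. (\<gamma> has_vector_derivative lfield U Z (\<gamma> t)) (at t)"
  have "((\<lambda>t. constr (\<gamma> t) (\<gamma> t)) has_vector_derivative 0) (at t within UNIV)" for t
    using has_vector_derivative_constr[OF \<gamma>(2)] by (simp add: constr_lfield[OF so])
  then obtain c where "constr (\<gamma> t) (\<gamma> t) = c" for t
    using has_vector_derivative_zero_constant[of UNIV "\<lambda>t. constr (\<gamma> t) (\<gamma> t)"] by auto
  then show "\<gamma> t \<in> W0"
    using x \<gamma>(1) by (metis W0_iff_constr)
qed

text \<open>The linearised equations are solved in turn, both times by \<open>mult_Mbar\<close>: the
  first yields U with Q U = A, and then B - P U satisfies the same tangency equation at Q, which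
  yields Z.\<close>

lemma lfield_exists:
  assumes x: "x \<in> W0" and v: "constr x v + constr v x = 0"
  obtains U Z where "U \<in> so" "Z \<in> so" "v = lfield U Z x"
proof -
  obtain Q P where xe: "x = (Q, P)" by (cases x)
  obtain A B where ve: "v = (A, B)" by (cases v)
  have Q: "Q ** transpose Q = mat 1"
    using x by (simp add: xe W0_def)
  have A: "Q ** transpose A + A ** transpose Q = 0"
    and B: "Q ** transpose B + P ** transpose A + (A ** transpose P + B ** transpose Q) = 0"
    using v by (simp_all add: xe ve constr_def zero_prod_def)
  define U where "U = Mbar Q A"
  have U: "U \<in> so" and QU: "Q ** U = A"
    using mult_Mbar[OF Q A] by (simp_all add: U_def Mbar_in_so)
  have "Q ** transpose (B - P ** U) + (B - P ** U) ** transpose Q = 0"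
    using B U unfolding QU[symmetric] by (simp add: so_def matrix_simps algebra_simps)
  from mult_Mbar[OF Q this] show thesis
    using that[OF U Mbar_in_so[of Q "B - P ** U"]] by (simp add: lfield_def xe ve QU)
qed

text \<open>Differentiating the constraints along a curve puts its velocity in the scope of
  \<open>lfield_exists\<close>; the flows give the converse.\<close>

lemma tangent_space_W0:
  assumes x: "x \<in> W0"
  shows "tangent_space W0 x = {lfield U Z x | U Z. U \<in> so \<and> Z \<in> so}"
proof (intro equalityI subsetI)
  fix X assume "X \<in> tangent_space W0 x"
  then obtain \<gamma> where \<gamma>: "smooth_curve_at W0 x \<gamma>" "(\<gamma> has_vector_derivative X) (at 0)"
    by (rule tangent_spaceE)
  have [simp]: "\<gamma> 0 = x" using \<gamma>(1) by (simp add: smooth_curve_at_def)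
  have "\<forall>\<^sub>F t in nhds 0. constr (\<gamma> t) (\<gamma> t) = (mat 1, 0)"
    using smooth_curve_at_eventually[OF \<gamma>(1)] by (simp add: W0_iff_constr)
  then have "((\<lambda>t. constr (\<gamma> t) (\<gamma> t)) has_vector_derivative 0) (at 0)"
    by (intro has_vector_derivative_eventually_eq[OF has_vector_derivative_const])
      (simp add: eq_commute)
  then have "constr x X + constr X x = 0"
    using has_vector_derivative_constr[OF \<gamma>(2)] vector_derivative_unique_at by fastforce
  with x show "X \<in> {lfield U Z x | U Z. U \<in> so \<and> Z \<in> so}"
    by (blast elim: lfield_exists)
qed (use x lfield_in_tangent_space in blast)

section \<open>Regularity of the constraints\<close>

text \<open>The constraints take values in pairs of symmetric matrices, and their differential is
  onto these pairs at every point of \<open>W0\<close>.\<close>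

lemma embedded_submanifold_W0:
  "\<exists>d. embedded_submanifold d (W0 :: ((real^'N::finite^'n::finite) \<times> (real^'N^'n)) set)"
proof -
  define Sym where "Sym = {A :: real^'n^'n. transpose A = A}"
  define D where "D = DIM((real^'N^'n) \<times> (real^'N^'n)) - dim (Sym \<times> Sym)"
  have Sym: "subspace (Sym \<times> Sym)"
    by (auto simp: subspace_def Sym_def matrix_simps zero_prod_def)
  have "\<exists>U (F :: (real^'N^'n) \<times> (real^'N^'n) \<Rightarrow> (real^'N^'n) \<times> (real^'N^'n)) S.
        open U \<and> p \<in> U \<and> subspace S \<and> dim S + D = DIM((real^'N^'n) \<times> (real^'N^'n)) \<and>
        smooth_on F U \<and> F ` U \<subseteq> S \<and> W0 \<inter> U = {x \<in> U. F x = 0} \<and>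
        range (frechet_derivative F (at p)) = S"
    if p: "p \<in> W0" for p :: "(real^'N^'n) \<times> (real^'N^'n)"
  proof -
    obtain Q P where pe: "p = (Q, P)" by (cases p)
    have Q: "Q ** transpose Q = mat 1" using p by (simp add: pe W0_def)
    \<comment> \<open>Right multiplication by the \<open>Q\<close> of the chosen point embeds the
      constraint values in the ambient space, as the definition of a submanifold requires. It is
      injective because \<open>Q ** transpose Q = mat 1\<close>.\<close>
    define J where "J y = (fst y ** Q, snd y ** Q)" for y :: "(real^'n^'n) \<times> (real^'n^'n)"
    define F where "F x = J (constr x x) + J (- mat 1, 0)" for x :: "(real^'N^'n) \<times> (real^'N^'n)"
    have J: "linear J" by (auto simp: linear_iff J_def matrix_simps)
    have F_eq: "F x = J (constr x x - (mat 1, 0))" for x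
      using linear_diff[OF J, of "constr x x" "(mat 1, 0)"] linear_neg[OF J, of "(mat 1, 0)"]
      by (simp add: F_def)
    have J_inj: "J y = J z \<longleftrightarrow> y = z" for y z
    proof
      assume "J y = J z"
      then have "fst y ** (Q ** transpose Q) = fst z ** (Q ** transpose Q)"
        "snd y ** (Q ** transpose Q) = snd z ** (Q ** transpose Q)"
        by (simp_all add: J_def matrix_mul_assoc)
      then show "y = z" by (simp add: Q prod_eq_iff)
    qed simp
    have bb: "bounded_bilinear (\<lambda>x y. J (constr x y))"
      unfolding bilinear_conv_bounded_bilinear[symmetric]
      by (auto simp: bilinear_def linear_iff J_def constr_def matrix_simps algebra_simps)
    define S where "S = J ` (Sym \<times> Sym)"
    have dimS: "dim S = dim (Sym \<times> Sym)"
      unfolding S_def using J by (rule dim_image_eq) (simp add: J_inj inj_on_def)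
    have "dim S \<le> DIM((real^'N^'n) \<times> (real^'N^'n))"
      by (rule dim_subset_UNIV)
    then have "dim S + D = DIM((real^'N^'n) \<times> (real^'N^'n))"
      unfolding D_def dimS by simp
    moreover have "subspace S"
      unfolding S_def using J Sym by (rule linear_subspace_image)
    moreover have "smooth_on F UNIV"
      unfolding F_def using bb by (rule smooth_on_quadratic)
    moreover have "F ` UNIV \<subseteq> S"
      by (auto simp: F_eq S_def Sym_def constr_def matrix_simps transpose_mat)
    moreover have "F x = 0 \<longleftrightarrow> x \<in> W0" for x
      using J_inj[of _ 0] by (simp add: F_eq linear_0[OF J] W0_iff_constr)
    moreover have "range (frechet_derivative F (at p)) = S"
    proof -
      have "(F has_derivative (\<lambda>v. J (constr p v) + J (constr v p))) (at p)"
        unfolding F_def using bb by (rule has_derivative_quadratic)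
      from frechet_derivative_at[OF this]
      have fd: "frechet_derivative F (at p) = (\<lambda>v. J (constr p v + constr v p))"
        by (simp add: linear_add[OF J])
      have "range (\<lambda>v. constr p v + constr v p) = Sym \<times> Sym"
      proof (intro equalityI subsetI)
        fix y assume "y \<in> Sym \<times> Sym"
        then obtain A B where y: "y = (A, B)" "transpose A = A" "transpose B = B"
          by (auto simp: Sym_def)
        \<comment> \<open>The linearised system is triangular. \<open>X\<close> solves the first
          equation, each summand contributing half of \<open>A\<close>; \<open>C\<close> is what
          then remains of the second, and \<open>Y\<close> solves it in the same way.\<close>
        define X where "X = (1 / 2) *\<^sub>R (A ** Q)"
        define C where "C = B - P ** transpose X - X ** transpose P"
        define Y where "Y = (1 / 2) *\<^sub>R (C ** Q)"
        have C: "transpose C = C" by (simp add: C_def y matrix_simps)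
        have sym: "Q ** transpose ((1 / 2) *\<^sub>R (E ** Q)) + (1 / 2) *\<^sub>R (E ** Q) ** transpose Q = E"
          if "transpose E = E" for E :: "real^'n^'n"
        proof -
          have "E ** Q ** transpose Q = E"
            using Q by (simp flip: matrix_mul_assoc)
          then show ?thesis using that
            by (simp add: matrix_simps Q flip: scaleR_add_left)
        qed
        have "constr p (X, Y) + constr (X, Y) p = y"
          using sym[OF y(2)] sym[OF C]
          by (simp add: constr_def pe y flip: X_def Y_def) (simp add: C_def algebra_simps)
        then show "y \<in> range (\<lambda>v. constr p v + constr v p)" by blast
      qed (auto simp: constr_def Sym_def matrix_simps)
      then show ?thesis
        unfolding fd S_def by (metis image_image)
    qed
    ultimately show ?thesis
      by (intro exI[of _ UNIV] exI[of _ F] exI[of _ S]) auto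
  qed
  then show ?thesis unfolding embedded_submanifold_def by blast
qed

section \<open>The form \<open>Omega\<close>\<close>

lemma bilinear_Omega: "bilinear (Omega p)"
  by (auto simp: bilinear_def linear_iff Omega_def frob_eq_inner algebra_simps inner_simps)

lemma Omega_self: "Omega p X X = 0"
  by (simp add: Omega_def frob_eq_inner inner_commute)

lemma nondegenerate_Omega: "nondegenerate_2form W0 Omega"
  unfolding nondegenerate_2form_def
proof (intro ballI impI)
  fix x X assume x: "x \<in> W0" and X: "X \<in> tangent_space W0 x"
    and 0: "\<forall>Y\<in>tangent_space W0 x. Omega x X Y = 0"
  obtain U Z where U: "U \<in> so" "Z \<in> so" and Xe: "X = lfield U Z x"
    using X tangent_space_W0[OF x] by auto
  have so0: "0 \<in> so" by (simp add: so_def matrix_simps)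
  \<comment> \<open>The test vector is (0, Q U) and \<open>fst X\<close> is Q U, so the pairing is
    the squared norm of Q U.\<close>
  have "Omega x X (lfield 0 U x) = 0"
    using 0 lfield_in_tangent_space[OF x so0 U(1)] by blast
  then have A: "fst x ** U = 0"
    by (simp add: Omega_def frob_eq_inner Xe lfield_def matrix_simps)
  have "constr x X + constr X x = 0"
    using U by (simp add: Xe constr_lfield)
  then have "fst x ** transpose (snd X) + snd X ** transpose (fst x) = 0"
    by (simp add: constr_def zero_prod_def Xe lfield_def A matrix_simps)
  moreover have "fst x ** transpose (fst x) = mat 1"
    using x by (simp add: W0_iff_constr constr_def)
  ultimately have M: "fst x ** Mbar (fst x) (snd X) = snd X"
    by (intro mult_Mbar)
  \<comment> \<open>The first component of this test vector is \<open>snd X\<close> and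
    \<open>fst X\<close> vanishes, so the pairing is minus the squared norm of
    \<open>snd X\<close>.\<close>
  have "Omega x X (lfield (Mbar (fst x) (snd X)) 0 x) = 0"
    using 0 lfield_in_tangent_space[OF x Mbar_in_so so0] by blast
  then have "snd X = 0"
    by (simp add: Omega_def frob_eq_inner lfield_def M) (simp add: Xe lfield_def A)
  then show "X = 0"
    using A by (simp add: prod_eq_iff Xe lfield_def)
qed

section \<open>The canonical one-form and its exterior derivative\<close>

lemma theta_eq:
  assumes "X \<in> tangent_space cotangent_stiefel p"
  shows "theta p X = snd p \<bullet> fst X"
proof -
  have "pushforward cotangent_stiefel fst p X = fst X"
    using assms
    by (rule pushforward_eqI)
      (simp add: comp_def bounded_linear.has_vector_derivative[OF bounded_linear_fst])
  then show ?thesis by (simp add: theta_def covector_def frob_eq_inner)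
qed

lemma extends_theta: "extends_1form W0 theta UNIV (\<lambda>q v. snd q \<bullet> fst v)"
  unfolding extends_1form_def
proof (intro conjI ballI allI)
  show "smooth_on (\<lambda>q. snd q \<bullet> fst v) UNIV" for v :: "(real^'N^'n) \<times> (real^'N^'n)"
    by (intro smooth_on_bounded_linear bounded_linear_inner_left_comp bounded_linear_snd)
qed (auto simp: linear_iff inner_simps theta_eq cotangent_stiefel_eq_W0)

text \<open>For the extension \<open>snd q \<bullet> fst v\<close> the exterior derivative is
  \<open>snd X \<bullet> fst Y - snd Y \<bullet> fst X\<close>, the negative of
  \<open>Omega\<close>.\<close>

lemma omega_c_eq_Omega:
  fixes x :: "(real^'N::finite^'n::finite) \<times> (real^'N^'n)"
  assumes x: "x \<in> W0" and X: "X \<in> tangent_space W0 x" and Y: "Y \<in> tangent_space W0 x"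
  shows "omega_c x X Y = Omega x X Y"
proof -
  obtain U Z where U: "U \<in> so" "Z \<in> so" "X = lfield U Z x"
    using X tangent_space_W0[OF x] by auto
  obtain U' Z' where U': "U' \<in> so" "Z' \<in> so" "Y = lfield U' Z' x"
    using Y tangent_space_W0[OF x] by auto
  \<comment> \<open>Tangency of the commutator is what makes the exterior derivative independent of
    the extension.\<close>
  have "lfield U' Z' (lfield U Z x) - lfield U Z (lfield U' Z' x) \<in> tangent_space W0 x"
    unfolding lfield_commutator using x U U'
    by (intro lfield_in_tangent_space so_add so_commutator)
  note eq = ext_deriv_1form_linear_fields[OF extends_theta UNIV_I x linear_lfield linear_lfield
      lfield_in_tangent_space[OF _ U(1,2)] lfield_in_tangent_space[OF _ U'(1,2)] this]
  have "((\<lambda>q. snd q \<bullet> fst v) has_derivative (\<lambda>h. snd h \<bullet> fst v)) (at x)"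
    for v :: "(real^'N^'n) \<times> (real^'N^'n)"
    by (intro bounded_linear_imp_has_derivative bounded_linear_inner_left_comp bounded_linear_snd)
  note fd = frechet_derivative_at[OF this, symmetric]
  show ?thesis
    by (simp add: omega_c_def cotangent_stiefel_eq_W0 U(3) U'(3) eq fd Omega_def frob_eq_inner)
      (simp add: inner_commute)
qed

section \<open>The map \<open>Phi\<close>\<close>

text \<open>A curve in \<open>W0\<close> agrees with its image under \<open>Phi\<close> near time 0,
  hence has the same velocity there.\<close>

lemma pushforward_Phi:
  assumes "X \<in> tangent_space W0 x"
  shows "pushforward W0 Phi x X = X"
  using assms
proof (rule pushforward_eqI)
  fix \<gamma> assume \<gamma>: "smooth_curve_at W0 x \<gamma>" "(\<gamma> has_vector_derivative X) (at 0)"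
  from smooth_curve_at_eventually[OF \<gamma>(1)]
  have "\<forall>\<^sub>F t in nhds 0. \<gamma> t = (Phi \<circ> \<gamma>) t"
    by eventually_elim (simp add: Phi_W0)
  with \<gamma>(2) show "((Phi \<circ> \<gamma>) has_vector_derivative X) (at 0)"
    by (rule has_vector_derivative_eventually_eq)
qed

lemma smooth_map_eq_id:
  assumes "\<And>x. x \<in> M \<Longrightarrow> f x = x"
  shows "smooth_map M f"
  unfolding smooth_map_def
  using assms smooth_on_bounded_linear[OF bounded_linear_ident, of UNIV]
  by (intro ballI exI[of _ UNIV] exI[of _ "\<lambda>x. x"]) auto

theorem theorem5:
  assumes "1 \<le> CARD('n::finite)" and "CARD('n) \<le> CARD('N::finite)"
  shows "symplectomorphism
           (W0 :: ((real^'N^'n) \<times> (real^'N^'n)) set) Omega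
           (cotangent_stiefel :: ((real^'N^'n) \<times> (real^'N^'n)) set) omega_c
           Phi"
proof -
  let ?W = "W0 :: ((real^'N^'n) \<times> (real^'N^'n)) set"
  \<comment> \<open>\<open>Omega\<close> does not depend on its base point, so its value at 0 serves
    as the constant extension.\<close>
  have Omega: "symplectic_manifold ?W Omega"
    unfolding symplectic_manifold_def
    by (intro conjI embedded_submanifold_W0 nondegenerate_Omega
        closed_2form_constant[where \<Xi> = "Omega 0"] bilinear_Omega Omega_self)
      (simp add: Omega_def)
  have "symplectic_manifold ?W omega_c"
    unfolding symplectic_manifold_def
  proof (intro conjI embedded_submanifold_W0
      closed_2form_constant[where \<Xi> = "Omega 0"] bilinear_Omega Omega_self)
    show "nondegenerate_2form ?W omega_c"
      using nondegenerate_Omega by (simp add: nondegenerate_2form_def omega_c_eq_Omega)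
  qed (simp add: omega_c_eq_Omega, simp add: Omega_def)
  moreover have "diffeomorphism_betw ?W ?W Phi"
  proof -
    have bij: "bij_betw Phi ?W ?W"
      by (rule bij_betw_cong[THEN iffD1, OF _ bij_betw_id]) (simp add: Phi_W0)
    have "inv_into ?W Phi x = x" if "x \<in> ?W" for x
      using that bij by (metis Phi_W0 bij_betw_inv_into_left)
    with bij show ?thesis
      by (simp add: diffeomorphism_betw_def smooth_map_eq_id Phi_W0)
  qed
  ultimately show ?thesis
    using Omega unfolding symplectomorphism_def cotangent_stiefel_eq_W0
    by (simp add: Phi_W0 pushforward_Phi omega_c_eq_Omega)
qed

end
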